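(* Let $X\in\mathbb{R}^{n\times p}$ be fixed and let $Y=X\beta+\varepsilon$ be the linear model described in the context. Let $\widehat{F}$ be any centered estimator of $F_0$, and let $c\in\mathbb{R}^p$ be any vector such that $v_\rho=v_\rho(X;c)\neq 0$. Then with $\mathbb{P}_\varepsilon$-probability 1, the following inequality holds for every $n\ge 1$ and every $\rho>0$: $$d_2^2\Big(\tfrac{1}{\sqrt{v_\rho}}\Psi_\rho(F_0;c),\ \tfrac{1}{\sqrt{v_\rho}}\Phi_\rho(\widehat{F};c)\Big)\ \le\ \tfrac{1}{\sigma^2}\,d_2^2(F_0,\widehat{F})+\frac{b_\rho^2}{v_\rho},$$ where $b_\rho^2=b_\rho^2(X;c)$.
   Context: Model: $Y=X\beta+\varepsilon\in\mathbb{R}^n$, where $X\in\mathbb{R}^{n\times p}$ is the observed design, $\beta\in\mathbb{R}^p$ is unknown, and the entries $\varepsilon_1,\dots,\varepsilon_n$ of $\varepsilon$ are i.i.d. from a distribution $F_0$ on $\mathbb{R}$ with mean $0$ and variance $\sigma^2<\infty$. $\mathbb{P}_\varepsilon$ is the distribution of $\varepsilon$. The model is one in a sequence indexed by $n$ ($X,\beta,p$ may vary with $n$; $F_0$ is fixed). For non-random $X$, conditioning on $X$ is only notation. Ridge estimator: $\widehat\beta_\rho=(X^\top X+\rho I_{p\times p})^{-1}X^\top Y$, $\rho>0$. $\Psi_\rho(F_0;c):=\mathcal{L}\big(c^\top(\widehat\beta_\rho-\beta)\,|\,X\big)$, where $\mathcal{L}$ denotes law. An estimator $\widehat F$ of $F_0$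 is a (random) probability distribution on $\mathbb{R}$ computed from the observations; centered means that it has mean zero. For a distribution $F$ on $\mathbb{R}$, $\Phi_\rho(F;c)$ is the law, conditionally on $X$ (and with $F$ held fixed), of $c^\top(X^\top X+\rho I_{p\times p})^{-1}X^\top\varepsilon^*$, where $\varepsilon^*\in\mathbb{R}^n$ has i.i.d. entries drawn from $F$. So $\Phi_\rho(\widehat F;c)$ is a random measure. For a scalar $a$, $a\,\mathcal{L}(U)$ denotes $\mathcal{L}(aU)$. Variance and bias: $v_\rho(X;c)=\sigma^2\|c^\top(X^\top X+\rho I_{p\times p})^{-1}X^\top\|_2^2$; $\delta(X)=\big[I_{p\times p}-(X^\top X+\rho I_{p\times p})^{-1}X^\top X\big]\beta$; $b_\rho^2(X;c)=(c^\top\delta(X))^2$. Mallows-$\ell_2$ metric: $d_2^2(\mathcal{L}(U),\mathcal{L}(V))=\inf_{\pi}\mathbb{E}\|U-V\|_2^2$, the infimum being over all joint distributions $\pi$ of $(U,V)$ with marginals $\mathcal{L}(U)$ and $\mathcal{L}(V)$. *)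

theory Defs
  imports "HOL-Probability.Probability" "Jordan_Normal_Form.Gauss_Jordan_Elimination"
begin

text \<open>Matrices and vectors are those of \<open>Jordan_Normal_Form.Matrix\<close>, with dimensions as natural
  numbers, because the models form a sequence indexed by the sample size.\<close>

definition centered :: "real measure \<Rightarrow> bool" where
  "centered F \<longleftrightarrow> integrable F (\<lambda>x. x) \<and> (\<integral>x. x \<partial>F) = 0"

definition scale_law :: "real \<Rightarrow> real measure \<Rightarrow> real measure" where
  "scale_law a \<mu> = distr \<mu> borel (\<lambda>x. a * x)"

definition couplings :: "'a::euclidean_space measure \<Rightarrow> 'a measure \<Rightarrow> ('a \<times> 'a) measure set" where
  "couplings \<mu> \<nu> = {\<pi>. sets \<pi> = sets (borel \<Otimes>\<^sub>M borel)
     \<and> distr \<pi> borel fst = \<mu> \<and> distr \<pi> borel snd = \<nu>}"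

text \<open>The squared Mallows distance. It takes the value \<open>\<infinity>\<close> when every coupling has infinite cost.\<close>

definition mallows_sq :: "'a::euclidean_space measure \<Rightarrow> 'a measure \<Rightarrow> ennreal" where
  "mallows_sq \<mu> \<nu> = (INF \<pi> \<in> couplings \<mu> \<nu>. \<integral>\<^sup>+ z. ennreal ((norm (fst z - snd z))\<^sup>2) \<partial>\<pi>)"

text \<open>The \<open>p \<times> n\<close> matrix \<open>(X\<^sup>T X + \<rho> I)\<^sup>-\<^sup>1 X\<^sup>T\<close>. For \<open>\<rho> > 0\<close> the inverted matrix is positive definite,
  so \<open>mat_inverse\<close> does not return \<open>None\<close>.\<close>

definition ridge_matrix :: "real \<Rightarrow> real mat \<Rightarrow> real mat" where
  "ridge_matrix \<rho> X =
     the (mat_inverse (transpose_mat X * X + \<rho> \<cdot>\<^sub>m 1\<^sub>m (dim_col X))) * transpose_mat X"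

definition ridge_estimator :: "real \<Rightarrow> real mat \<Rightarrow> real vec \<Rightarrow> real vec" where
  "ridge_estimator \<rho> X y = ridge_matrix \<rho> X *\<^sub>v y"

definition response :: "real mat \<Rightarrow> real vec \<Rightarrow> (nat \<Rightarrow> 'w \<Rightarrow> real) \<Rightarrow> 'w \<Rightarrow> real vec" where
  "response X \<beta> \<epsilon> \<omega> = X *\<^sub>v \<beta> + vec (dim_row X) (\<lambda>i. \<epsilon> i \<omega>)"

definition Psi_law ::
  "'w measure \<Rightarrow> (nat \<Rightarrow> 'w \<Rightarrow> real) \<Rightarrow> real mat \<Rightarrow> real vec \<Rightarrow> real \<Rightarrow> real vec \<Rightarrow> real measure" where
  "Psi_law M \<epsilon> X \<beta> \<rho> c =
     distr M borel (\<lambda>\<omega>. scalar_prod c (ridge_estimator \<rho> X (response X \<beta> \<epsilon> \<omega>) - \<beta>))"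

definition Phi_law :: "real mat \<Rightarrow> real \<Rightarrow> real measure \<Rightarrow> real vec \<Rightarrow> real measure" where
  "Phi_law X \<rho> F c =
     distr (\<Pi>\<^sub>M i\<in>{..<dim_row X}. F) borel
       (\<lambda>e. scalar_prod c (ridge_matrix \<rho> X *\<^sub>v vec (dim_row X) e))"

text \<open>The row vector \<open>c\<^sup>T A\<close> is represented by the vector \<open>A\<^sup>T c\<close>.\<close>

definition ridge_variance :: "real \<Rightarrow> real \<Rightarrow> real mat \<Rightarrow> real vec \<Rightarrow> real" where
  "ridge_variance \<sigma> \<rho> X c =
     \<sigma>\<^sup>2 * (\<Sum>i<dim_row X. ((transpose_mat (ridge_matrix \<rho> X) *\<^sub>v c) $ i)\<^sup>2)"

definition ridge_delta :: "real \<Rightarrow> real mat \<Rightarrow> real vec \<Rightarrow> real vec" where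
  "ridge_delta \<rho> X \<beta> = (1\<^sub>m (dim_col X) - ridge_matrix \<rho> X * X) *\<^sub>v \<beta>"

definition ridge_bias_sq :: "real \<Rightarrow> real mat \<Rightarrow> real vec \<Rightarrow> real vec \<Rightarrow> real" where
  "ridge_bias_sq \<rho> X \<beta> c = (scalar_prod c (ridge_delta \<rho> X \<beta>))\<^sup>2"

text \<open>An estimator of a distribution on the line is a probability kernel evaluated at the observed
  response, which is passed as an element of the product space \<open>\<Pi>\<^sub>M i\<in>{..<n}. borel\<close>. The design is
  not random, so dependence on it needs no separate argument.\<close>

definition law_estimator :: "nat \<Rightarrow> ((nat \<Rightarrow> real) \<Rightarrow> real measure) \<Rightarrow> bool" where
  "law_estimator n G \<longleftrightarrow> G \<in> (\<Pi>\<^sub>M i\<in>{..<n}. borel) \<rightarrow>\<^sub>M prob_algebra borel"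

definition estimate :: "((nat \<Rightarrow> real) \<Rightarrow> real measure) \<Rightarrow> real vec \<Rightarrow> real measure" where
  "estimate G y = G (\<lambda>i\<in>{..<dim_vec y}. y $ i)"

end

theory Submission
  imports Defs "Jordan_Normal_Form.Determinant"
begin

text \<open>
  Put \<open>A = (X\<^sup>T X + \<rho> I)\<^sup>-\<^sup>1 X\<^sup>T\<close>, \<open>a = A\<^sup>T c\<close>, and let \<open>b = c\<^sup>T \<delta>\<close> be the signed bias. Substituting
  \<open>Y = X \<beta> + \<epsilon>\<close> gives \<open>c\<^sup>T (A Y - \<beta>) = (\<Sum>i. a\<^sub>i \<epsilon>\<^sub>i) - b\<close>, so both laws to be compared are images of
  product measures: \<open>\<Psi>\<close> is the law of \<open>(\<Sum>i. a\<^sub>i e\<^sub>i) - b\<close> with i.i.d. entries from \<open>F\<^sub>0\<close>, and \<open>\<Phi>\<close> is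
  the law of \<open>\<Sum>i. a\<^sub>i e\<^sub>i\<close> with i.i.d. entries from the estimate.

  Any coupling \<open>\<pi>\<close> of \<open>F\<^sub>0\<close> and \<open>F\<close> of finite cost is turned into a coupling of these two laws by drawing \<open>n\<close>
  independent pairs \<open>(U\<^sub>i, V\<^sub>i)\<close> from \<open>\<pi>\<close>. Its cost is the second moment of \<open>(\<Sum>i. a\<^sub>i (U\<^sub>i - V\<^sub>i)) - b\<close>.
  Both marginals are centered, so the differences are independent with mean zero; every mixed term
  vanishes, and the cost is \<open>(\<Sum>i. a\<^sub>i\<^sup>2) E (U - V)\<^sup>2 + b\<^sup>2\<close>. The infimum over \<open>\<pi>\<close> is taken in
  \<open>mallows_sq_iid_affine_le\<close>. Scaling by \<open>1 / sqrt v\<close> with \<open>v = \<sigma>\<^sup>2 (\<Sum>i. a\<^sub>i\<^sup>2)\<close> turns the two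
  coefficients into \<open>1 / \<sigma>\<^sup>2\<close> and \<open>b\<^sup>2 / v\<close>.

  The inequality therefore holds for every outcome at which the estimate is centered, for all
  \<open>\<rho>\<close> at once; the exceptional set is the union over the countably many \<open>n\<close> of the null
  sets on which centering fails.
\<close>

section \<open>Second moments of centered i.i.d. sums\<close>

lemma (in prob_space) has_bochner_integral_PiM_component:
  fixes g :: "'a \<Rightarrow> real"
  assumes i: "i \<in> I" and g: "integrable M g"
  shows "has_bochner_integral (\<Pi>\<^sub>M i\<in>I. M) (\<lambda>x. g (x i)) (expectation g)"
proof -
  have d: "distr (\<Pi>\<^sub>M i\<in>I. M) M (\<lambda>x. x i) = M"
    using distr_PiM_component[of I "\<lambda>_. M" i] i prob_space_axioms by simp
  have [measurable]: "(\<lambda>x. x i) \<in> (\<Pi>\<^sub>M i\<in>I. M) \<rightarrow>\<^sub>M M"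
    using i by measurable
  have [measurable]: "g \<in> borel_measurable M"
    using g by auto
  have "integrable (\<Pi>\<^sub>M i\<in>I. M) (\<lambda>x. g (x i))"
    using g integrable_distr_eq[of "\<lambda>x. x i" "\<Pi>\<^sub>M i\<in>I. M" M g] d by simp
  moreover have "(\<integral>x. g (x i) \<partial>(\<Pi>\<^sub>M i\<in>I. M)) = expectation g"
    using integral_distr[of "\<lambda>x. x i" "\<Pi>\<^sub>M i\<in>I. M" M g] d by simp
  ultimately show ?thesis
    by (simp add: has_bochner_integral_iff)
qed

lemma (in prob_space) has_bochner_integral_PiM_two_components:
  fixes g :: "'a \<Rightarrow> real"
  assumes I: "finite I" and ij: "i \<in> I" "j \<in> I" "i \<noteq> j" and g: "integrable M g"
  shows "has_bochner_integral (\<Pi>\<^sub>M i\<in>I. M) (\<lambda>x. g (x i) * g (x j)) ((expectation g)\<^sup>2)"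
proof -
  interpret product_sigma_finite "\<lambda>_. M" ..
  \<comment> \<open>Factors other than \<open>i\<close> and \<open>j\<close> are the constant 1, whose mean is 1 for a probability measure.\<close>
  define f where "f k = (if k \<in> {i, j} then g else (\<lambda>_. 1))" for k
  have f: "integrable M (f k)" for k
    using g by (auto simp: f_def)
  have restrict: "(\<Prod>k\<in>I. h k) = h i * h j"
    if "\<And>k. k \<in> I \<Longrightarrow> k \<notin> {i, j} \<Longrightarrow> h k = 1" for h :: "_ \<Rightarrow> real"
  proof -
    have "(\<Prod>k\<in>I. h k) = (\<Prod>k\<in>{i, j}. h k)"
      using that I ij by (intro prod.mono_neutral_right) auto
    then show ?thesis using ij by simp
  qed
  have "(\<Prod>k\<in>I. f k (x k)) = g (x i) * g (x j)" for x
    by (subst restrict) (auto simp: f_def)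
  moreover have "(\<Prod>k\<in>I. expectation (f k)) = (expectation g)\<^sup>2"
    by (subst restrict) (auto simp: f_def prob_space power2_eq_square)
  ultimately show ?thesis
    using product_integrable_prod[OF I, of f] product_integral_prod[OF I, of f] f
    by (simp add: has_bochner_integral_iff)
qed

text \<open>Expanding the square, independence and centering leave only the diagonal and the shift.\<close>

lemma (in prob_space) has_bochner_integral_PiM_affine_square:
  fixes g :: "'a \<Rightarrow> real" and a :: "'i \<Rightarrow> real"
  assumes I: "finite I" and g: "integrable M g" "expectation g = 0"
    and g2: "integrable M (\<lambda>x. (g x)\<^sup>2)"
  shows "has_bochner_integral (\<Pi>\<^sub>M i\<in>I. M) (\<lambda>x. ((\<Sum>i\<in>I. a i * g (x i)) - b)\<^sup>2)
           ((\<Sum>i\<in>I. (a i)\<^sup>2) * expectation (\<lambda>x. (g x)\<^sup>2) + b\<^sup>2)"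
proof -
  let ?P = "\<Pi>\<^sub>M i\<in>I. M"
  let ?v = "expectation (\<lambda>x. (g x)\<^sup>2)"
  interpret P: prob_space ?P
    by (intro prob_space_PiM prob_space_axioms)
  have pair: "has_bochner_integral ?P (\<lambda>x. g (x i) * g (x j)) (if i = j then ?v else 0)"
    if "i \<in> I" "j \<in> I" for i j
    using has_bochner_integral_PiM_component[OF that(1) g2]
      has_bochner_integral_PiM_two_components[OF I that _ g(1)] g(2)
    by (auto simp: power2_eq_square)
  have "has_bochner_integral ?P
      (\<lambda>x. (\<Sum>i\<in>I. \<Sum>j\<in>I. (a i * a j) * (g (x i) * g (x j)))
            - (2 * b) * (\<Sum>i\<in>I. a i * g (x i)) + b\<^sup>2)
      ((\<Sum>i\<in>I. \<Sum>j\<in>I. (a i * a j) * (if i = j then ?v else 0))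
            - (2 * b) * (\<Sum>i\<in>I. a i * 0) + b\<^sup>2)"
  proof (intro has_bochner_integral_add has_bochner_integral_diff has_bochner_integral_sum
      has_bochner_integral_mult_right pair)
    show "has_bochner_integral ?P (\<lambda>x. g (x i)) 0" if "i \<in> I" for i
      using has_bochner_integral_PiM_component[OF that g(1)] g(2) by simp
    show "has_bochner_integral ?P (\<lambda>_. b\<^sup>2) (b\<^sup>2)"
      by (simp add: has_bochner_integral_iff P.prob_space)
  qed auto
  moreover have "(\<Sum>i\<in>I. \<Sum>j\<in>I. (a i * a j) * (if i = j then ?v else 0)) = (\<Sum>i\<in>I. (a i)\<^sup>2) * ?v"
    using I by (simp add: if_distrib[of "\<lambda>z. _ * z"] power2_eq_square sum_distrib_right
        cong: if_cong)
  moreover have "(\<Sum>i\<in>I. \<Sum>j\<in>I. (a i * a j) * (g (x i) * g (x j)))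
      - (2 * b) * (\<Sum>i\<in>I. a i * g (x i)) + b\<^sup>2 = ((\<Sum>i\<in>I. a i * g (x i)) - b)\<^sup>2" for x
  proof -
    have "(\<Sum>i\<in>I. \<Sum>j\<in>I. (a i * a j) * (g (x i) * g (x j))) = (\<Sum>i\<in>I. a i * g (x i))\<^sup>2"
      by (simp add: power2_eq_square sum_product mult_ac)
    then show ?thesis
      by (simp add: power2_diff)
  qed
  ultimately show ?thesis by simp
qed

section \<open>The Mallows distance between weighted i.i.d. sums\<close>

lemma couplings_prob_space:
  assumes "\<pi> \<in> couplings F G" and "prob_space F"
  shows "prob_space \<pi>"
proof -
  have "fst \<in> \<pi> \<rightarrow>\<^sub>M borel" "distr \<pi> borel fst = F"
    using assms(1) measurable_cong_sets[of \<pi> "borel \<Otimes>\<^sub>M borel" borel borel]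
    by (auto simp: couplings_def)
  then show ?thesis
    using assms(2) by (metis prob_space_distrD)
qed

text \<open>Projecting every coordinate of \<open>\<Pi>\<^sub>M i\<in>I. \<pi>\<close> onto its first (second) entry yields the product of
  the first (second) marginals of \<open>\<pi>\<close>, and each weighted sum sees only one of the two projections.\<close>

lemma iid_affine_coupling:
  fixes F G :: "real measure" and a :: "'i \<Rightarrow> real" and b :: real
  assumes I: "finite I" and F: "prob_space F" and G: "prob_space G" and \<pi>: "\<pi> \<in> couplings F G"
  defines "T \<equiv> \<lambda>x. ((\<Sum>i\<in>I. a i * fst (x i)) - b, \<Sum>i\<in>I. a i * snd (x i))"
  shows "distr (\<Pi>\<^sub>M i\<in>I. \<pi>) (borel \<Otimes>\<^sub>M borel) T
    \<in> couplings (distr (\<Pi>\<^sub>M i\<in>I. F) borel (\<lambda>e. (\<Sum>i\<in>I. a i * e i) - b))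
                (distr (\<Pi>\<^sub>M i\<in>I. G) borel (\<lambda>e. \<Sum>i\<in>I. a i * e i))"
proof -
  have [measurable_cong]: "sets \<pi> = sets (borel \<Otimes>\<^sub>M borel)"
    and dF: "distr \<pi> borel fst = F" and dG: "distr \<pi> borel snd = G"
    using \<pi> by (auto simp: couplings_def)
  have sF [measurable_cong]: "sets F = sets borel" and sG [measurable_cong]: "sets G = sets borel"
    using dF dG by (metis sets_distr)+
  have p: "prob_space \<pi>"
    using couplings_prob_space[OF \<pi> F] .
  have T [measurable]: "T \<in> (\<Pi>\<^sub>M i\<in>I. \<pi>) \<rightarrow>\<^sub>M borel \<Otimes>\<^sub>M borel"
    unfolding T_def by measurable
  have mF: "fst \<in> \<pi> \<rightarrow>\<^sub>M F" and mG: "snd \<in> \<pi> \<rightarrow>\<^sub>M G"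
    by measurable
  have PF: "distr (\<Pi>\<^sub>M i\<in>I. \<pi>) (\<Pi>\<^sub>M i\<in>I. F) (compose I fst) = (\<Pi>\<^sub>M i\<in>I. F)"
    using distr_PiM_finite_prob_space'[OF I p F mF] dF distr_cong[OF refl sF, of \<pi> fst fst] by simp
  have PG: "distr (\<Pi>\<^sub>M i\<in>I. \<pi>) (\<Pi>\<^sub>M i\<in>I. G) (compose I snd) = (\<Pi>\<^sub>M i\<in>I. G)"
    using distr_PiM_finite_prob_space'[OF I p G mG] dG distr_cong[OF refl sG, of \<pi> snd snd] by simp
  have cF [measurable]: "compose I fst \<in> (\<Pi>\<^sub>M i\<in>I. \<pi>) \<rightarrow>\<^sub>M (\<Pi>\<^sub>M i\<in>I. F)"
    unfolding compose_def by measurable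
  have cG [measurable]: "compose I snd \<in> (\<Pi>\<^sub>M i\<in>I. \<pi>) \<rightarrow>\<^sub>M (\<Pi>\<^sub>M i\<in>I. G)"
    unfolding compose_def by measurable
  have hF: "(\<lambda>e. (\<Sum>i\<in>I. a i * e i) - b) \<in> borel_measurable (\<Pi>\<^sub>M i\<in>I. F)"
    and hG: "(\<lambda>e. \<Sum>i\<in>I. a i * e i) \<in> borel_measurable (\<Pi>\<^sub>M i\<in>I. G)"
    by measurable
  have "distr (distr (\<Pi>\<^sub>M i\<in>I. \<pi>) (borel \<Otimes>\<^sub>M borel) T) borel fst
      = distr (\<Pi>\<^sub>M i\<in>I. \<pi>) borel (\<lambda>x. (\<Sum>i\<in>I. a i * fst (x i)) - b)"
    by (subst distr_distr) (auto simp: T_def comp_def)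
  also have "\<dots> = distr (distr (\<Pi>\<^sub>M i\<in>I. \<pi>) (\<Pi>\<^sub>M i\<in>I. F) (compose I fst)) borel
      (\<lambda>e. (\<Sum>i\<in>I. a i * e i) - b)"
    by (subst distr_distr[OF hF cF]) (auto simp: compose_def comp_def)
  finally have 1: "distr (distr (\<Pi>\<^sub>M i\<in>I. \<pi>) (borel \<Otimes>\<^sub>M borel) T) borel fst
      = distr (\<Pi>\<^sub>M i\<in>I. F) borel (\<lambda>e. (\<Sum>i\<in>I. a i * e i) - b)"
    by (simp add: PF)
  have "distr (distr (\<Pi>\<^sub>M i\<in>I. \<pi>) (borel \<Otimes>\<^sub>M borel) T) borel snd
      = distr (\<Pi>\<^sub>M i\<in>I. \<pi>) borel (\<lambda>x. \<Sum>i\<in>I. a i * snd (x i))"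
    by (subst distr_distr) (auto simp: T_def comp_def)
  also have "\<dots> = distr (distr (\<Pi>\<^sub>M i\<in>I. \<pi>) (\<Pi>\<^sub>M i\<in>I. G) (compose I snd)) borel
      (\<lambda>e. \<Sum>i\<in>I. a i * e i)"
    by (subst distr_distr[OF hG cG]) (auto simp: compose_def comp_def)
  finally have 2: "distr (distr (\<Pi>\<^sub>M i\<in>I. \<pi>) (borel \<Otimes>\<^sub>M borel) T) borel snd
      = distr (\<Pi>\<^sub>M i\<in>I. G) borel (\<lambda>e. \<Sum>i\<in>I. a i * e i)"
    by (simp add: PG)
  show ?thesis
    using 1 2 by (simp add: couplings_def)
qed

text \<open>Finite cost makes \<open>U - V\<close> square integrable, and its mean is the difference of two zero means.
  The second moment formula therefore applies with \<open>g (u, v) = u - v\<close>.\<close>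

lemma iid_affine_coupling_cost:
  fixes F G :: "real measure" and a :: "'i \<Rightarrow> real" and b :: real
  assumes I: "finite I" and F: "prob_space F" "centered F" and G: "prob_space G" "centered G"
    and \<pi>: "\<pi> \<in> couplings F G"
    and fin: "(\<integral>\<^sup>+ z. ennreal ((norm (fst z - snd z))\<^sup>2) \<partial>\<pi>) < \<infinity>"
  shows "(\<integral>\<^sup>+ x. ennreal (((\<Sum>i\<in>I. a i * (fst (x i) - snd (x i))) - b)\<^sup>2) \<partial>(\<Pi>\<^sub>M i\<in>I. \<pi>))
    = ennreal (\<Sum>i\<in>I. (a i)\<^sup>2) * (\<integral>\<^sup>+ z. ennreal ((norm (fst z - snd z))\<^sup>2) \<partial>\<pi>) + ennreal (b\<^sup>2)"
proof -
  have [measurable_cong]: "sets \<pi> = sets (borel \<Otimes>\<^sub>M borel)"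
    and dF: "distr \<pi> borel fst = F" and dG: "distr \<pi> borel snd = G"
    using \<pi> by (auto simp: couplings_def)
  interpret prob_space \<pi>
    using couplings_prob_space[OF \<pi> F(1)] .
  let ?g = "\<lambda>z :: real \<times> real. fst z - snd z"
  have mF: "fst \<in> \<pi> \<rightarrow>\<^sub>M borel" and mG: "snd \<in> \<pi> \<rightarrow>\<^sub>M borel"
    by measurable
  have iF: "integrable \<pi> fst" and eF: "expectation fst = 0"
    using F(2) integrable_distr_eq[OF mF, of "\<lambda>x. x"] integral_distr[OF mF, of "\<lambda>x. x"]
    by (auto simp: centered_def dF)
  have iG: "integrable \<pi> snd" and eG: "expectation snd = 0"
    using G(2) integrable_distr_eq[OF mG, of "\<lambda>x. x"] integral_distr[OF mG, of "\<lambda>x. x"]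
    by (auto simp: centered_def dG)
  have g: "integrable \<pi> ?g" "expectation ?g = 0"
    using iF iG eF eG by auto
  have g2: "integrable \<pi> (\<lambda>z. (?g z)\<^sup>2)"
    using fin by (intro integrableI_nonneg) auto
  have cost: "(\<integral>\<^sup>+ z. ennreal ((norm (fst z - snd z))\<^sup>2) \<partial>\<pi>) = ennreal (expectation (\<lambda>z. (?g z)\<^sup>2))"
    using nn_integral_eq_integral[OF g2] by simp
  note sq = has_bochner_integral_PiM_affine_square[OF I g g2, of a b]
  have "(\<integral>\<^sup>+ x. ennreal (((\<Sum>i\<in>I. a i * (fst (x i) - snd (x i))) - b)\<^sup>2) \<partial>(\<Pi>\<^sub>M i\<in>I. \<pi>))
      = ennreal ((\<Sum>i\<in>I. (a i)\<^sup>2) * expectation (\<lambda>z. (?g z)\<^sup>2) + b\<^sup>2)"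
    using sq by (subst nn_integral_eq_integral) (auto simp: has_bochner_integral_iff)
  also have "\<dots> = ennreal (\<Sum>i\<in>I. (a i)\<^sup>2) * ennreal (expectation (\<lambda>z. (?g z)\<^sup>2)) + ennreal (b\<^sup>2)"
    by (simp add: ennreal_mult sum_nonneg)
  finally show ?thesis
    unfolding cost .
qed

text \<open>Only points of finite value have to be examined: if there are none, the infimum is \<open>\<infinity>\<close>, and
  \<open>r > 0\<close> makes the right-hand side infinite too.\<close>

lemma ennreal_le_cmult_INF_add:
  fixes f :: "'a \<Rightarrow> ennreal"
  assumes r: "0 < r" and s: "0 \<le> s" and le: "\<And>x. x \<in> A \<Longrightarrow> f x < \<infinity> \<Longrightarrow> l \<le> ennreal r * f x + ennreal s"
  shows "l \<le> ennreal r * (INF x\<in>A. f x) + ennreal s"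
proof -
  have "(l - ennreal s) / ennreal r \<le> (INF x\<in>A. f x)"
  proof (rule INF_greatest)
    fix x assume x: "x \<in> A"
    show "(l - ennreal s) / ennreal r \<le> f x"
    proof (cases "f x < \<infinity>")
      case True
      then have "l - ennreal s \<le> ennreal r * f x"
        using le[OF x] by (simp add: ennreal_minus_le_iff add.commute)
      then show ?thesis
        using r by (intro divide_le_posI_ennreal) (auto simp: mult.commute)
    qed (simp add: not_less top_unique)
  qed
  then have "ennreal r * ((l - ennreal s) / ennreal r) \<le> ennreal r * (INF x\<in>A. f x)"
    by (rule mult_left_mono) simp
  also have "ennreal r * ((l - ennreal s) / ennreal r) = l - ennreal s"
    using r by (simp add: ennreal_times_divide mult.commute[of "ennreal r"] ennreal_mult_divide_eq)
  finally show ?thesis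
    by (simp add: ennreal_minus_le_iff add.commute)
qed

text \<open>With a positive sum of squares an infinite distance between \<open>F\<close> and \<open>G\<close> makes the bound
  infinite, so only couplings of finite cost matter, and for those the cost of the induced coupling
  is known exactly.\<close>

lemma mallows_sq_iid_affine_le:
  fixes F G :: "real measure" and a :: "'i \<Rightarrow> real" and b :: real
  assumes I: "finite I" and F: "prob_space F" "centered F" and G: "prob_space G" "centered G"
    and pos: "0 < (\<Sum>i\<in>I. (a i)\<^sup>2)"
  shows "mallows_sq (distr (\<Pi>\<^sub>M i\<in>I. F) borel (\<lambda>e. (\<Sum>i\<in>I. a i * e i) - b))
                    (distr (\<Pi>\<^sub>M i\<in>I. G) borel (\<lambda>e. \<Sum>i\<in>I. a i * e i))
    \<le> ennreal (\<Sum>i\<in>I. (a i)\<^sup>2) * mallows_sq F G + ennreal (b\<^sup>2)"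
    (is "mallows_sq ?L ?R \<le> _")
  unfolding mallows_sq_def[of F G]
proof (rule ennreal_le_cmult_INF_add[OF pos])
  fix \<pi> :: "(real \<times> real) measure"
  assume \<pi>: "\<pi> \<in> couplings F G" and fin: "(\<integral>\<^sup>+ z. ennreal ((norm (fst z - snd z))\<^sup>2) \<partial>\<pi>) < \<infinity>"
  have [measurable_cong]: "sets \<pi> = sets (borel \<Otimes>\<^sub>M borel)"
    using \<pi> by (auto simp: couplings_def)
  let ?T = "\<lambda>x. ((\<Sum>i\<in>I. a i * fst (x i)) - b, \<Sum>i\<in>I. a i * snd (x i))"
  have [measurable]: "?T \<in> (\<Pi>\<^sub>M i\<in>I. \<pi>) \<rightarrow>\<^sub>M borel \<Otimes>\<^sub>M borel"
    by measurable
  have "mallows_sq ?L ?R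
      \<le> (\<integral>\<^sup>+ z. ennreal ((norm (fst z - snd z))\<^sup>2) \<partial>distr (\<Pi>\<^sub>M i\<in>I. \<pi>) (borel \<Otimes>\<^sub>M borel) ?T)"
    unfolding mallows_sq_def by (intro INF_lower iid_affine_coupling I F G \<pi>)
  also have "\<dots> = (\<integral>\<^sup>+ x. ennreal (((\<Sum>i\<in>I. a i * (fst (x i) - snd (x i))) - b)\<^sup>2) \<partial>(\<Pi>\<^sub>M i\<in>I. \<pi>))"
    by (subst nn_integral_distr) (auto simp: right_diff_distrib sum_subtractf algebra_simps)
  also have "\<dots> = ennreal (\<Sum>i\<in>I. (a i)\<^sup>2) * (\<integral>\<^sup>+ z. ennreal ((norm (fst z - snd z))\<^sup>2) \<partial>\<pi>)
      + ennreal (b\<^sup>2)"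
    by (rule iid_affine_coupling_cost[OF I F G \<pi> fin])
  finally show "mallows_sq ?L ?R
      \<le> ennreal (\<Sum>i\<in>I. (a i)\<^sup>2) * (\<integral>\<^sup>+ z. ennreal ((norm (fst z - snd z))\<^sup>2) \<partial>\<pi>) + ennreal (b\<^sup>2)" .
qed simp

section \<open>The ridge matrix and the two laws\<close>

lemma scalar_prod_self_nonneg:
  fixes v :: "real vec"
  shows "0 \<le> v \<bullet> v"
  by (simp add: scalar_prod_def sum_nonneg)

lemma scalar_prod_self_eq_0D:
  fixes v :: "real vec"
  assumes "v \<in> carrier_vec n" "v \<bullet> v = 0"
  shows "v = 0\<^sub>v n"
  using assms by (intro eq_vecI) (auto simp: scalar_prod_def sum_nonneg_eq_0_iff)

text \<open>The penalized Gram matrix has trivial kernel, since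
  \<open>v \<bullet> (X\<^sup>T X + \<rho> I) v = \<parallel>X v\<parallel>\<^sup>2 + \<rho> \<parallel>v\<parallel>\<^sup>2\<close>; hence its inverse exists and has the expected format.\<close>

lemma ridge_matrix_carrier:
  assumes X: "X \<in> carrier_mat n p" and \<rho>: "0 < \<rho>"
  shows "ridge_matrix \<rho> X \<in> carrier_mat p n"
proof -
  let ?A = "transpose_mat X * X + \<rho> \<cdot>\<^sub>m 1\<^sub>m p"
  have A: "?A \<in> carrier_mat p p"
    using X by auto
  have "Determinant.det ?A \<noteq> 0"
  proof
    assume "Determinant.det ?A = 0"
    then obtain v where v: "v \<in> carrier_vec p" "v \<noteq> 0\<^sub>v p" "?A *\<^sub>v v = 0\<^sub>v p"
      using det_0_iff_vec_prod_zero_field[OF A] by auto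
    have Xv: "X *\<^sub>v v \<in> carrier_vec n"
      using X v(1) by simp
    have I: "(\<rho> \<cdot>\<^sub>m 1\<^sub>m p) *\<^sub>v v = \<rho> \<cdot>\<^sub>v v"
      using v(1) by (intro eq_vecI) (auto simp: smult_scalar_prod_distrib[of _ p])
    have "?A *\<^sub>v v = transpose_mat X *\<^sub>v (X *\<^sub>v v) + \<rho> \<cdot>\<^sub>v v"
      using X v(1) by (simp add: add_mult_distrib_mat_vec[of _ p p] I assoc_mult_mat_vec[of _ p n _ p])
    then have "0 = (transpose_mat X *\<^sub>v (X *\<^sub>v v) + \<rho> \<cdot>\<^sub>v v) \<bullet> v"
      using v(1,3) by (metis scalar_prod_left_zero)
    also have "\<dots> = (X *\<^sub>v v) \<bullet> (X *\<^sub>v v) + \<rho> * (v \<bullet> v)"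
      using X v(1) Xv transpose_vec_mult_scalar[OF X v(1) Xv]
      by (subst add_scalar_prod_distrib[of _ p]) auto
    finally have "v \<bullet> v = 0"
      using scalar_prod_self_nonneg[of "X *\<^sub>v v"] scalar_prod_self_nonneg[of v] \<rho>
      by (smt (verit) mult_pos_pos)
    then show False
      using scalar_prod_self_eq_0D[OF v(1)] v(2) by simp
  qed
  then have "?A \<in> Units (ring_mat TYPE(real) p ())"
    by (rule det_non_zero_imp_unit[OF A])
  then obtain B where "mat_inverse ?A = Some B"
    using mat_inverse(1)[OF A, where b = "()"] by (cases "mat_inverse ?A") auto
  moreover have "B \<in> carrier_mat p p"
    using mat_inverse(2)[OF A] calculation by auto
  ultimately show ?thesis
    using X by (simp add: ridge_matrix_def)
qed

lemma scalar_prod_mult_vec_eq_sum: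
  fixes A :: "real mat"
  assumes A: "A \<in> carrier_mat p n" and c: "c \<in> carrier_vec p"
  shows "c \<bullet> (A *\<^sub>v vec n e) = (\<Sum>i<n. (transpose_mat A *\<^sub>v c) $ i * e i)"
proof -
  have "c \<bullet> (A *\<^sub>v vec n e) = (transpose_mat A *\<^sub>v c) \<bullet> vec n e"
    using transpose_vec_mult_scalar[OF A _ c, of "vec n e"] by simp
  also have "\<dots> = (\<Sum>i<n. (transpose_mat A *\<^sub>v c) $ i * e i)"
    by (simp add: scalar_prod_def lessThan_atLeast0)
  finally show ?thesis .
qed

lemma ridge_error_decomposition:
  assumes X: "X \<in> carrier_mat n p" and \<beta>: "\<beta> \<in> carrier_vec p" and c: "c \<in> carrier_vec p"
    and \<rho>: "0 < \<rho>"
  shows "c \<bullet> (ridge_estimator \<rho> X (response X \<beta> \<epsilon> \<omega>) - \<beta>)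
    = (\<Sum>i<n. (transpose_mat (ridge_matrix \<rho> X) *\<^sub>v c) $ i * \<epsilon> i \<omega>) - c \<bullet> ridge_delta \<rho> X \<beta>"
proof -
  let ?R = "ridge_matrix \<rho> X"
  let ?e = "vec n (\<lambda>i. \<epsilon> i \<omega>)"
  have R: "?R \<in> carrier_mat p n"
    by (rule ridge_matrix_carrier[OF X \<rho>])
  have Xb: "X *\<^sub>v \<beta> \<in> carrier_vec n"
    using X \<beta> by simp
  have RXb: "?R *\<^sub>v (X *\<^sub>v \<beta>) \<in> carrier_vec p" and Re: "?R *\<^sub>v ?e \<in> carrier_vec p"
    using R Xb by auto
  have est: "ridge_estimator \<rho> X (response X \<beta> \<epsilon> \<omega>) = ?R *\<^sub>v (X *\<^sub>v \<beta>) + ?R *\<^sub>v ?e"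
    using X R Xb by (simp add: ridge_estimator_def response_def mult_add_distrib_mat_vec)
  have delta: "ridge_delta \<rho> X \<beta> = \<beta> - ?R *\<^sub>v (X *\<^sub>v \<beta>)"
    using X R \<beta> by (simp add: ridge_delta_def minus_mult_distrib_mat_vec[of _ p p]
        assoc_mult_mat_vec[of _ p n _ p])
  have "c \<bullet> (ridge_estimator \<rho> X (response X \<beta> \<epsilon> \<omega>) - \<beta>)
      = c \<bullet> (?R *\<^sub>v (X *\<^sub>v \<beta>)) + c \<bullet> (?R *\<^sub>v ?e) - c \<bullet> \<beta>"
    unfolding est using RXb Re \<beta> c
    by (simp add: scalar_prod_minus_distrib[of _ p] scalar_prod_add_distrib[of _ p])
  also have "\<dots> = c \<bullet> (?R *\<^sub>v ?e) - c \<bullet> ridge_delta \<rho> X \<beta>"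
    unfolding delta using RXb \<beta> c by (simp add: scalar_prod_minus_distrib[of _ p])
  finally show ?thesis
    by (simp add: scalar_prod_mult_vec_eq_sum[OF R c])
qed

lemma scaled_Psi_law_eq:
  assumes M: "prob_space M" and n: "1 \<le> n"
    and X: "X \<in> carrier_mat n p" and \<beta>: "\<beta> \<in> carrier_vec p" and c: "c \<in> carrier_vec p"
    and \<rho>: "0 < \<rho>"
    and indep: "prob_space.indep_vars M (\<lambda>i. borel) \<epsilon> {..<n}"
    and law: "\<And>i. i < n \<Longrightarrow> distr M borel (\<epsilon> i) = F"
  shows "scale_law s (Psi_law M \<epsilon> X \<beta> \<rho> c) = distr (\<Pi>\<^sub>M i\<in>{..<n}. F) borel
    (\<lambda>e. (\<Sum>i<n. (s * (transpose_mat (ridge_matrix \<rho> X) *\<^sub>v c) $ i) * e i)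
         - s * (c \<bullet> ridge_delta \<rho> X \<beta>))"
proof -
  interpret prob_space M by (rule M)
  let ?a = "\<lambda>i. (transpose_mat (ridge_matrix \<rho> X) *\<^sub>v c) $ i"
  let ?b = "c \<bullet> ridge_delta \<rho> X \<beta>"
  have \<epsilon>: "\<epsilon> i \<in> borel_measurable M" if "i \<in> {..<n}" for i
    using indep that by (auto simp: indep_vars_def)
  have ne: "{..<n} \<noteq> {}"
    using n by (auto simp: lessThan_empty_iff)
  have sF [measurable_cong]: "sets F = sets borel"
    using law[of 0] n by (metis sets_distr less_le_trans less_one)
  have joint: "distr M (\<Pi>\<^sub>M i\<in>{..<n}. borel) (\<lambda>\<omega>. \<lambda>i\<in>{..<n}. \<epsilon> i \<omega>) = (\<Pi>\<^sub>M i\<in>{..<n}. F)"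
    using PiM_cong[of "{..<n}" "{..<n}" "\<lambda>i. distr M borel (\<epsilon> i)" "\<lambda>_. F"] law
      indep indep_vars_iff_distr_eq_PiM'[OF ne, where X = \<epsilon> and M' = "\<lambda>_. borel"] \<epsilon>
    by simp
  have m: "(\<lambda>\<omega>. \<lambda>i\<in>{..<n}. \<epsilon> i \<omega>) \<in> M \<rightarrow>\<^sub>M (\<Pi>\<^sub>M i\<in>{..<n}. borel)"
    using \<epsilon> by (intro measurable_restrict)
  have h: "(\<lambda>e. (\<Sum>i<n. (s * ?a i) * e i) - s * ?b) \<in> borel_measurable (\<Pi>\<^sub>M i\<in>{..<n}. borel)"
    by measurable
  have e: "(\<lambda>\<omega>. (\<Sum>i<n. ?a i * \<epsilon> i \<omega>) - ?b) \<in> borel_measurable M"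
    using \<epsilon> by (intro borel_measurable_diff borel_measurable_sum borel_measurable_times) auto
  have "scale_law s (Psi_law M \<epsilon> X \<beta> \<rho> c) = distr M borel (\<lambda>\<omega>. s * ((\<Sum>i<n. ?a i * \<epsilon> i \<omega>) - ?b))"
    using e by (simp add: scale_law_def Psi_law_def ridge_error_decomposition[OF X \<beta> c \<rho>]
        distr_distr comp_def)
  also have "\<dots> = distr (distr M (\<Pi>\<^sub>M i\<in>{..<n}. borel) (\<lambda>\<omega>. \<lambda>i\<in>{..<n}. \<epsilon> i \<omega>)) borel
      (\<lambda>e. (\<Sum>i<n. (s * ?a i) * e i) - s * ?b)"
    by (subst distr_distr[OF h m])
      (simp add: comp_def right_diff_distrib sum_distrib_left mult.assoc)
  finally show ?thesis
    by (simp add: joint)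
qed

lemma scaled_Phi_law_eq:
  assumes X: "X \<in> carrier_mat n p" and c: "c \<in> carrier_vec p" and \<rho>: "0 < \<rho>"
    and F: "sets F = sets borel"
  shows "scale_law s (Phi_law X \<rho> F c) = distr (\<Pi>\<^sub>M i\<in>{..<n}. F) borel
    (\<lambda>e. \<Sum>i<n. (s * (transpose_mat (ridge_matrix \<rho> X) *\<^sub>v c) $ i) * e i)"
proof -
  note [measurable_cong] = F
  have R: "ridge_matrix \<rho> X \<in> carrier_mat p n"
    by (rule ridge_matrix_carrier[OF X \<rho>])
  have [measurable]: "(\<lambda>e. \<Sum>i<n. (transpose_mat (ridge_matrix \<rho> X) *\<^sub>v c) $ i * e i)
      \<in> borel_measurable (\<Pi>\<^sub>M i\<in>{..<n}. F)"
    by measurable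
  show ?thesis
    using X by (simp add: scale_law_def Phi_law_def scalar_prod_mult_vec_eq_sum[OF R c] distr_distr
        comp_def sum_distrib_left mult.assoc)
qed

lemma estimate_prob_space_borel:
  assumes G: "law_estimator n G" and y: "dim_vec y = n"
  shows "prob_space (estimate G y)" "sets (estimate G y) = sets borel"
proof -
  have "(\<lambda>i\<in>{..<n}. y $ i) \<in> space (\<Pi>\<^sub>M i\<in>{..<n}. (borel :: real measure))"
    by (simp add: space_PiM)
  then have "estimate G y \<in> space (prob_algebra borel)"
    using G y measurable_space[of G "\<Pi>\<^sub>M i\<in>{..<n}. borel" "prob_algebra borel"]
    by (simp add: estimate_def law_estimator_def)
  then show "prob_space (estimate G y)" "sets (estimate G y) = sets borel"
    by (auto simp: space_prob_algebra)
qed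

section \<open>The ridge bootstrap bound\<close>

text \<open>The observed outcome enters the bound only through the estimate, so it can be proved for a fixed
  law \<open>F\<close>. The scaling factor is absorbed into the weights and the shift, after which the weights have
  sum of squares \<open>1 / \<sigma>\<^sup>2\<close>.\<close>

lemma mallows_sq_ridge_le:
  assumes M: "prob_space M" and n: "1 \<le> n"
    and X: "X \<in> carrier_mat n p" and \<beta>: "\<beta> \<in> carrier_vec p" and c: "c \<in> carrier_vec p"
    and \<rho>: "0 < \<rho>"
    and indep: "prob_space.indep_vars M (\<lambda>i. borel) \<epsilon> {..<n}"
    and law: "\<And>i. i < n \<Longrightarrow> distr M borel (\<epsilon> i) = F\<^sub>0"
    and F\<^sub>0: "prob_space F\<^sub>0" "centered F\<^sub>0"
    and F: "prob_space F" "sets F = sets borel" "centered F"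
    and v: "ridge_variance \<sigma> \<rho> X c \<noteq> 0"
  shows "mallows_sq (scale_law (1 / sqrt (ridge_variance \<sigma> \<rho> X c)) (Psi_law M \<epsilon> X \<beta> \<rho> c))
                    (scale_law (1 / sqrt (ridge_variance \<sigma> \<rho> X c)) (Phi_law X \<rho> F c))
    \<le> ennreal (1 / \<sigma>\<^sup>2) * mallows_sq F\<^sub>0 F
      + ennreal (ridge_bias_sq \<rho> X \<beta> c / ridge_variance \<sigma> \<rho> X c)"
proof -
  let ?v = "ridge_variance \<sigma> \<rho> X c"
  let ?s = "1 / sqrt ?v"
  let ?a = "\<lambda>i. (transpose_mat (ridge_matrix \<rho> X) *\<^sub>v c) $ i"
  let ?b = "c \<bullet> ridge_delta \<rho> X \<beta>"
  have v_eq: "?v = \<sigma>\<^sup>2 * (\<Sum>i<n. (?a i)\<^sup>2)"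
    using X by (simp add: ridge_variance_def)
  then have "0 \<le> ?v"
    by (simp add: sum_nonneg)
  then have s2: "?s\<^sup>2 = 1 / ?v"
    by (simp add: power_divide)
  have nz: "\<sigma> \<noteq> 0" "(\<Sum>i<n. (?a i)\<^sup>2) \<noteq> 0"
    using v v_eq by auto
  have "(\<Sum>i<n. (?s * ?a i)\<^sup>2) = ?s\<^sup>2 * (\<Sum>i<n. (?a i)\<^sup>2)"
    unfolding power_mult_distrib sum_distrib_left ..
  also have "\<dots> = 1 / \<sigma>\<^sup>2"
    unfolding s2 unfolding v_eq using nz by simp
  finally have coeff: "(\<Sum>i<n. (?s * ?a i)\<^sup>2) = 1 / \<sigma>\<^sup>2" .
  have bias: "(?s * ?b)\<^sup>2 = ridge_bias_sq \<rho> X \<beta> c / ?v"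
    unfolding power_mult_distrib s2 ridge_bias_sq_def by simp
  have pos: "0 < (\<Sum>i<n. (?s * ?a i)\<^sup>2)"
    unfolding coeff using nz by simp
  have Psi: "scale_law ?s (Psi_law M \<epsilon> X \<beta> \<rho> c)
      = distr (\<Pi>\<^sub>M i\<in>{..<n}. F\<^sub>0) borel (\<lambda>e. (\<Sum>i<n. (?s * ?a i) * e i) - ?s * ?b)"
    using law by (rule scaled_Psi_law_eq[OF M n X \<beta> c \<rho> indep])
  show ?thesis
    using mallows_sq_iid_affine_le[OF finite_lessThan F\<^sub>0 F(1,3) pos, of "?s * ?b"]
    unfolding Psi scaled_Phi_law_eq[OF X c \<rho> F(2)] coeff bias .
qed

theorem theorem1:
  fixes M :: "'w measure"
    and F\<^sub>0 :: "real measure"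
    and \<sigma> :: real
    and p :: "nat \<Rightarrow> nat"
    and X :: "nat \<Rightarrow> real mat"
    and \<beta> c :: "nat \<Rightarrow> real vec"
    and \<epsilon> :: "nat \<Rightarrow> nat \<Rightarrow> 'w \<Rightarrow> real"
    and Fhat :: "nat \<Rightarrow> (nat \<Rightarrow> real) \<Rightarrow> real measure"
  assumes "prob_space M"
    and "real_distribution F\<^sub>0"
    and "centered F\<^sub>0"
    and "integrable F\<^sub>0 (\<lambda>x. x\<^sup>2)"
    and "prob_space.variance F\<^sub>0 (\<lambda>x. x) = \<sigma>\<^sup>2"
    and "\<And>n. 1 \<le> n \<Longrightarrow> X n \<in> carrier_mat n (p n)"
    and "\<And>n. 1 \<le> n \<Longrightarrow> \<beta> n \<in> carrier_vec (p n)"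
    and "\<And>n. 1 \<le> n \<Longrightarrow> c n \<in> carrier_vec (p n)"
    and "\<And>n. 1 \<le> n \<Longrightarrow> prob_space.indep_vars M (\<lambda>i. borel) (\<epsilon> n) {..<n}"
    and "\<And>n i. 1 \<le> n \<Longrightarrow> i < n \<Longrightarrow> distr M borel (\<epsilon> n i) = F\<^sub>0"
    and "\<And>n. 1 \<le> n \<Longrightarrow> law_estimator n (Fhat n)"
    and "\<And>n. 1 \<le> n \<Longrightarrow>
           AE \<omega> in M. centered (estimate (Fhat n) (response (X n) (\<beta> n) (\<epsilon> n) \<omega>))"
  shows "AE \<omega> in M. \<forall>n\<ge>1. \<forall>\<rho>>0. ridge_variance \<sigma> \<rho> (X n) (c n) \<noteq> 0 \<longrightarrow>
    (let v = ridge_variance \<sigma> \<rho> (X n) (c n);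
         F = estimate (Fhat n) (response (X n) (\<beta> n) (\<epsilon> n) \<omega>)
     in mallows_sq (scale_law (1 / sqrt v) (Psi_law M (\<epsilon> n) (X n) (\<beta> n) \<rho> (c n)))
                   (scale_law (1 / sqrt v) (Phi_law (X n) \<rho> F (c n)))
        \<le> ennreal (1 / \<sigma>\<^sup>2) * mallows_sq F\<^sub>0 F
          + ennreal (ridge_bias_sq \<rho> (X n) (\<beta> n) (c n) / v))"
proof -
  \<comment> \<open>A single null set serves all sample sizes.\<close>
  have "AE \<omega> in M. \<forall>n. 1 \<le> n \<longrightarrow>
      centered (estimate (Fhat n) (response (X n) (\<beta> n) (\<epsilon> n) \<omega>))"
    using assms(12) by (subst AE_all_countable) auto
  then show ?thesis
  proof eventually_elim
    case (elim \<omega>)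
    show ?case
      unfolding Let_def
    proof (intro allI impI)
      fix n :: nat and \<rho> :: real
      assume n: "1 \<le> n" and \<rho>: "0 < \<rho>" and v: "ridge_variance \<sigma> \<rho> (X n) (c n) \<noteq> 0"
      have y: "dim_vec (response (X n) (\<beta> n) (\<epsilon> n) \<omega>) = n"
        using assms(6)[OF n] by (simp add: response_def)
      have F\<^sub>0: "prob_space F\<^sub>0"
        using assms(2) by (simp add: real_distribution_def)
      show "mallows_sq
          (scale_law (1 / sqrt (ridge_variance \<sigma> \<rho> (X n) (c n))) (Psi_law M (\<epsilon> n) (X n) (\<beta> n) \<rho> (c n)))
          (scale_law (1 / sqrt (ridge_variance \<sigma> \<rho> (X n) (c n)))
            (Phi_law (X n) \<rho> (estimate (Fhat n) (response (X n) (\<beta> n) (\<epsilon> n) \<omega>)) (c n)))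
        \<le> ennreal (1 / \<sigma>\<^sup>2) * mallows_sq F\<^sub>0 (estimate (Fhat n) (response (X n) (\<beta> n) (\<epsilon> n) \<omega>))
          + ennreal (ridge_bias_sq \<rho> (X n) (\<beta> n) (c n) / ridge_variance \<sigma> \<rho> (X n) (c n))"
        using n \<rho> v elim F\<^sub>0
        by (intro mallows_sq_ridge_le[OF assms(1) n assms(6-8)[OF n] \<rho> assms(9)[OF n]]
            assms(3,10) estimate_prob_space_borel[OF assms(11)[OF n] y]) auto
    qed
  qed
qed

end
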